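(* There is no compact metric space universal for Lipschitz quotients onto all (nonempty) compact metric spaces; that is, there is no compact metric space $M$ such that for every nonempty compact metric space $N$ there exists a Lipschitz quotient $f\colon M\to N$.
   Context: For a metric space $M$, $B_M(x,r)$ denotes the closed ball of center $x$ and radius $r$. The co-Lipschitz constant $\text{co-Lip}(f)$ of a map $f\colon M\to N$ between metric spaces is the infimum of all $C>0$ such that $B_N(f(x),r)\subset f(B_M(x,Cr))$ for all $x\in M$ and all $r>0$; $f$ is co-Lipschitz if $\text{co-Lip}(f)<\infty$. A Lipschitz quotient is a map that is both Lipschitz and co-Lipschitz (no bound is imposed on the constants). *)

theory Defs
  imports "HOL-Analysis.Analysis"
begin

definition co_Lip :: "'a metric \<Rightarrow> 'b metric \<Rightarrow> ('a \<Rightarrow> 'b) \<Rightarrow> ereal" where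
  "co_Lip M N f =
    Inf (ereal ` {C::real. C > 0 \<and>
      (\<forall>x\<in>mspace M. \<forall>r>0. mcball_of N (f x) r \<subseteq> f ` mcball_of M x (C * r))})"

definition co_Lipschitz_map :: "'a metric \<Rightarrow> 'b metric \<Rightarrow> ('a \<Rightarrow> 'b) \<Rightarrow> bool" where
  "co_Lipschitz_map M N f \<longleftrightarrow> f \<in> mspace M \<rightarrow> mspace N \<and> co_Lip M N f < \<infinity>"

definition Lipschitz_quotient :: "'a metric \<Rightarrow> 'b metric \<Rightarrow> ('a \<Rightarrow> 'b) \<Rightarrow> bool" where
  "Lipschitz_quotient M N f \<longleftrightarrow> Lipschitz_continuous_map M N f \<and> co_Lipschitz_map M N f"

text \<open>If \<open>mspace M = {}\<close>, then every \<open>f\<close> is vacuously a Lipschitz quotient from \<open>M\<close>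
  to any space, so the domain has to be assumed nonempty wherever Lipschitz quotients are meant
  to be onto; for nonempty \<open>M\<close> surjectivity follows from the ball inclusion.\<close>

text \<open>A compact metric space has at most continuum many points, so it is isometric to
  a space whose carrier is a set of reals (with a metric unrelated to the usual distance).
  Hence quantifying over all compact \<^typ>\<open>real metric\<close> covers all compact
  metric spaces up to isometry.\<close>

lemma compact_metric_isometric_to_real_metric:
  fixes N :: "'b metric"
  assumes "compact_space (mtopology_of N)"
  shows "\<exists>(N' :: real metric) h. bij_betw h (mspace N) (mspace N') \<and>
           (\<forall>x\<in>mspace N. \<forall>y\<in>mspace N. mdist N' (h x) (h y) = mdist N x y)"
proof -
  interpret N: Metric_space "mspace N" "mdist N"
    by (rule Metric_space_mspace_mdist)
  have "N.mtotally_bounded (mspace N)"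
    using assms N.compact_space_eq_mcomplete_mtotally_bounded
    by (simp add: mtopology_of_def)
  then have "\<forall>k::nat. \<exists>K. finite K \<and> K \<subseteq> mspace N \<and>
      mspace N \<subseteq> (\<Union>x\<in>K. N.mball x (1 / real (Suc k)))"
    unfolding N.mtotally_bounded_def by (meson of_nat_0_less_iff zero_less_Suc zero_less_divide_1_iff)
  then obtain F where F: "\<And>k::nat. finite (F k)" "\<And>k. F k \<subseteq> mspace N"
      "\<And>k. mspace N \<subseteq> (\<Union>x\<in>F k. N.mball x (1 / real (Suc k)))"
    by metis
  define S where "S = (UNIV::nat set) \<times> (\<Union>k. F k)"
  have S: "countable S"
    unfolding S_def by (intro countable_SIGMA countable_UN) (auto simp: F countable_finite)
  define g where "g x = {(k,y). y \<in> F k \<and> mdist N y x < 1 / real (Suc k)}" for x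
  have gS: "g x \<subseteq> S" for x
    by (auto simp: g_def S_def)
  have g: "inj_on g (mspace N)"
  proof (rule inj_onI, rule ccontr)
    fix x y assume xy: "x \<in> mspace N" "y \<in> mspace N" "g x = g y" "x \<noteq> y"
    then have "mdist N x y > 0"
      by simp
    then obtain k where k: "1 / real (Suc k) < mdist N x y / 2"
      using nat_approx_posE[of "mdist N x y / 2"] by auto
    obtain p where p: "p \<in> F k" "mdist N p x < 1 / real (Suc k)"
      using F(3)[of k] xy(1) by auto
    then have "(k,p) \<in> g y"
      using xy(3) by (auto simp: g_def)
    then have "mdist N p y < 1 / real (Suc k)"
      by (auto simp: g_def)
    moreover have "mdist N x y \<le> mdist N p x + mdist N p y"
      using F(2) p xy N.triangle'' by (metis N.commute N.triangle subsetD)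
    ultimately show False
      using p k by linarith
  qed
  have "inj_on (image (to_nat_on S)) (Pow S)"
    using inj_on_to_nat_on[OF S] by (metis inj_on_image_Pow)
  then have "inj_on (\<lambda>x. to_nat_on S ` g x) (mspace N)"
    using g gS unfolding inj_on_def by (metis PowI)
  moreover obtain c :: "nat set \<Rightarrow> real" where "inj c"
    using nat_sets_eqpoll_reals by (auto simp: eqpoll_def bij_betw_def)
  ultimately obtain h :: "'b \<Rightarrow> real" where h: "inj_on h (mspace N)"
    by (metis comp_inj_on inj_on_subset subset_UNIV)
  define d where "d a b = mdist N (inv_into (mspace N) h a) (inv_into (mspace N) h b)" for a b
  have "Metric_space (h ` mspace N) d"
  proof
    fix a b c assume "a \<in> h ` mspace N" "b \<in> h ` mspace N" "c \<in> h ` mspace N"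
    then show "d a c \<le> d a b + d b c"
      unfolding d_def by (intro N.triangle) (auto intro: inv_into_into)
  qed (use h in \<open>auto simp: d_def N.commute\<close>)
  then have "mspace (metric (h ` mspace N, d)) = h ` mspace N" "mdist (metric (h ` mspace N, d)) = d"
    by (simp_all add: Metric_space.mspace_metric Metric_space.mdist_metric)
  then show ?thesis
    using h by (intro exI[of _ "metric (h ` mspace N, d)"] exI[of _ h])
      (auto simp: bij_betw_def d_def)
qed

end

theory Submission
  imports Defs
begin

text \<open>Preimages under an \<open>L\<close>-Lipschitz surjection of an \<open>L e\<close>-separated set are \<open>e\<close>-separated.
  Let \<open>n k\<close> bound the cardinality of every \<open>1/k\<^sup>2\<close>-separated subset of \<open>M\<close>. The hedgehog with
  \<open>n k + 1\<close> tips at distance \<open>1/k\<close> from its centre, for every \<open>k \<ge> 1\<close>, is compact; preimages of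
  the tips of level \<open>k\<close> under an \<open>L\<close>-Lipschitz surjection are \<open>2/(kL)\<close>-separated, and thus
  \<open>1/k\<^sup>2\<close>-separated once \<open>k \<ge> L\<close>, a contradiction. (In the formal proof \<open>Suc k\<close>
  plays the role of \<open>k\<close>.)\<close>

text \<open>The ball inclusion at a single point \<open>x\<close> suffices, since its radius may be
  arbitrarily large.\<close>

lemma Lipschitz_quotient_surj:
  assumes "Lipschitz_quotient M N f" "mspace M \<noteq> {}"
  shows "f ` mspace M = mspace N"
proof -
  have f: "f \<in> mspace M \<rightarrow> mspace N" and fin: "co_Lip M N f < \<infinity>"
    using assms(1) by (auto simp: Lipschitz_quotient_def co_Lipschitz_map_def)
  from fin obtain C :: real where
    C: "\<And>x r. x \<in> mspace M \<Longrightarrow> r > 0 \<Longrightarrow> mcball_of N (f x) r \<subseteq> f ` mcball_of M x (C * r)"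
    unfolding co_Lip_def Inf_less_iff by blast
  obtain x where x: "x \<in> mspace M"
    using assms(2) by auto
  have "y \<in> f ` mspace M" if y: "y \<in> mspace N" for y
  proof -
    \<comment> \<open>Adding 1 keeps the radius positive even when \<open>f x = y\<close>.\<close>
    have "y \<in> mcball_of N (f x) (mdist N (f x) y + 1)"
      using x y f by auto
    then have "y \<in> f ` mcball_of M x (C * (mdist N (f x) y + 1))"
      using C[OF x, of "mdist N (f x) y + 1"] by (auto simp: add_nonneg_pos)
    then show ?thesis
      by auto
  qed
  then show ?thesis
    using f by blast
qed

text \<open>Total boundedness gives a finite cover by open balls of radius \<open>e / 2\<close>.
  Each of them contains at most one point of \<open>T\<close>, so the number of balls is a bound
  that does not depend on \<open>T\<close>.\<close>

lemma compact_separated_card_bound: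
  assumes "compact_space (mtopology_of M)" and "e > 0"
  shows "\<exists>n. \<forall>T \<subseteq> mspace M. (\<forall>x\<in>T. \<forall>y\<in>T. x \<noteq> y \<longrightarrow> e \<le> mdist M x y) \<longrightarrow> card T \<le> n"
proof -
  interpret M: Metric_space "mspace M" "mdist M"
    by (rule Metric_space_mspace_mdist)
  have "M.mtotally_bounded (mspace M)"
    using assms(1) M.compact_space_eq_mcomplete_mtotally_bounded
    by (simp add: mtopology_of_def)
  then obtain K where K: "finite K" "K \<subseteq> mspace M" "mspace M \<subseteq> (\<Union>x\<in>K. M.mball x (e / 2))"
    unfolding M.mtotally_bounded_def using assms(2) half_gt_zero by metis
  have "card T \<le> card K"
    if T: "T \<subseteq> mspace M" and sep: "\<forall>x\<in>T. \<forall>y\<in>T. x \<noteq> y \<longrightarrow> e \<le> mdist M x y" for T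
  proof -
    have "\<forall>x\<in>T. \<exists>c\<in>K. x \<in> M.mball c (e / 2)"
      using T K(3) by blast
    then obtain c where c: "\<And>x. x \<in> T \<Longrightarrow> c x \<in> K \<and> x \<in> M.mball (c x) (e / 2)"
      by metis
    have "inj_on c T"
    proof (rule inj_onI, rule ccontr)
      fix x y assume xy: "x \<in> T" "y \<in> T" "c x = c y" "x \<noteq> y"
      then have "mdist M x y \<le> mdist M (c x) x + mdist M (c x) y"
        using c[OF xy(1)] c[OF xy(2)] by (metis M.in_mball M.triangle'')
      then show False
        using c[OF xy(1)] c[OF xy(2)] xy sep by fastforce
    qed
    then show ?thesis
      using c K(1) by (intro card_inj_on_le[of c]) auto
  qed
  then show ?thesis
    by blast
qed

text \<open>Path length through the centre, with \<open>\<bar>w x\<bar>\<close> the length of the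
  spike ending in \<open>x\<close>. The absolute values give nonnegativity and the triangle
  inequality for every \<open>w\<close>.\<close>

definition hedgehog_dist :: "('a \<Rightarrow> real) \<Rightarrow> 'a \<Rightarrow> 'a \<Rightarrow> real" where
  "hedgehog_dist w x y = (if x = y then 0 else \<bar>w x\<bar> + \<bar>w y\<bar>)"

lemma Metric_space_hedgehog:
  assumes "\<And>x. x \<in> A \<Longrightarrow> w x = 0 \<Longrightarrow> x = z"
  shows "Metric_space A (hedgehog_dist w)"
proof
  show "hedgehog_dist w x y = 0 \<longleftrightarrow> x = y" if "x \<in> A" "y \<in> A" for x y
    using assms[OF that(1)] assms[OF that(2)] by (auto simp: hedgehog_dist_def add_nonneg_eq_0_iff)
qed (auto simp: hedgehog_dist_def)

text \<open>A cover member containing the centre \<open>z\<close> contains all points of weight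
  below some \<open>e > 0\<close>; the finitely many others need one member each.\<close>

lemma compact_space_hedgehog:
  assumes zero: "\<And>x. x \<in> A \<Longrightarrow> w x = 0 \<Longrightarrow> x = z"
    and z: "z \<in> A" "w z = 0"
    and fin: "\<And>e. e > 0 \<Longrightarrow> finite {x \<in> A. e \<le> \<bar>w x\<bar>}"
  shows "compact_space (Metric_space.mtopology A (hedgehog_dist w))"
proof -
  interpret Metric_space A "hedgehog_dist w"
    by (rule Metric_space_hedgehog) (rule zero)
  show ?thesis
    unfolding compact_space_alt topspace_mtopology
  proof (intro allI impI, elim conjE)
    fix \<U> assume op: "\<forall>U\<in>\<U>. openin mtopology U" and cov: "A \<subseteq> \<Union>\<U>"
    obtain U e where U: "U \<in> \<U>" "e > 0" "mball z e \<subseteq> U"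
      using op cov z(1) openin_mtopology by (metis UnionE subsetD)
    have "\<forall>x\<in>A. \<exists>V. x \<in> V \<and> V \<in> \<U>"
      using cov by blast
    then obtain V where V: "\<And>x. x \<in> A \<Longrightarrow> x \<in> V x \<and> V x \<in> \<U>"
      by metis
    have "x \<in> U" if "x \<in> A" "\<not> e \<le> \<bar>w x\<bar>" for x
      using that U z by (intro subsetD[OF U(3)]) (auto simp: hedgehog_dist_def)
    then show "\<exists>\<F>. finite \<F> \<and> \<F> \<subseteq> \<U> \<and> A \<subseteq> \<Union>\<F>"
      using fin[OF U(2)] U(1) V by (intro exI[of _ "insert U (V ` {x \<in> A. e \<le> \<bar>w x\<bar>})"]) auto
  qed
qed

theorem theorem2:
  shows "\<not> (\<exists>M :: 'a metric. mspace M \<noteq> {} \<and> compact_space (mtopology_of M) \<and>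
    (\<forall>N :: real metric. mspace N \<noteq> {} \<and> compact_space (mtopology_of N) \<longrightarrow>
      (\<exists>f. Lipschitz_quotient M N f)))"
proof (intro notI, elim exE conjE)
  fix M :: "'a metric"
  assume ne: "mspace M \<noteq> {}" and cpt: "compact_space (mtopology_of M)"
    and univ: "\<forall>N :: real metric. mspace N \<noteq> {} \<and> compact_space (mtopology_of N) \<longrightarrow>
      (\<exists>f. Lipschitz_quotient M N f)"
  \<comment> \<open>The scale is fixed before \<open>L\<close> is known: spike length
    \<open>1 / real (Suc k)\<close> divided by this threshold is \<open>Suc k\<close>, which
    eventually exceeds any \<open>L\<close>.\<close>
  have "\<forall>k. \<exists>n. \<forall>T \<subseteq> mspace M.
      (\<forall>x\<in>T. \<forall>y\<in>T. x \<noteq> y \<longrightarrow> 1 / (real (Suc k))\<^sup>2 \<le> mdist M x y) \<longrightarrow> card T \<le> n"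
    using compact_separated_card_bound[OF cpt] by simp
  then obtain n where n: "\<And>k T. T \<subseteq> mspace M \<Longrightarrow>
      (\<And>x y. x \<in> T \<Longrightarrow> y \<in> T \<Longrightarrow> x \<noteq> y \<Longrightarrow> 1 / (real (Suc k))\<^sup>2 \<le> mdist M x y) \<Longrightarrow>
      card T \<le> n k"
    by metis
  \<comment> \<open>\<open>None\<close> is the centre and \<open>Some (k, i)\<close> is tip
    \<open>i\<close> of level \<open>k\<close>; \<open>t\<close> codes them as reals because
    \<open>N\<close> must be a \<open>real metric\<close>.\<close>
  define t :: "(nat \<times> nat) option \<Rightarrow> real" where "t x = real (to_nat x)" for x
  have "inj t"
    by (auto simp: inj_def t_def)
  \<comment> \<open>\<open>{..n k}\<close> has \<open>n k + 1\<close> elements, one more than a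
    separated set at level \<open>k\<close> can have.\<close>
  define A where "A = insert (t None) (t ` Some ` (SIGMA k:UNIV. {..n k}))"
  define w where "w = case_option 0 (\<lambda>(k, i). 1 / real (Suc k)) \<circ> inv t"
  have w: "w (t None) = 0" "\<And>k i. w (t (Some (k, i))) = 1 / real (Suc k)"
    using \<open>inj t\<close> by (simp_all add: w_def)
  have w0: "x = t None" if "x \<in> A" "w x = 0" for x
    using that by (auto simp: A_def w)
  interpret H: Metric_space A "hedgehog_dist w"
    by (rule Metric_space_hedgehog) (rule w0)
  have "finite {x \<in> A. e \<le> \<bar>w x\<bar>}" if "e > 0" for e
  proof -
    \<comment> \<open>Tips of levels beyond \<open>m\<close> lie closer than \<open>e\<close> to the
      centre, and each remaining level is finite.\<close>
    obtain m where m: "1 / real (Suc m) < e"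
      using nat_approx_posE[OF \<open>e > 0\<close>] by blast
    have "k \<le> m" if "e \<le> 1 / real (Suc k)" for k
    proof (rule ccontr)
      assume "\<not> k \<le> m"
      then have "1 / real (Suc k) \<le> 1 / real (Suc m)"
        by (intro divide_left_mono) auto
      with m that show False
        by linarith
    qed
    then have "{x \<in> A. e \<le> \<bar>w x\<bar>} \<subseteq> t ` Some ` (SIGMA k:{..m}. {..n k})"
      using \<open>e > 0\<close> by (auto simp: A_def w)
    then show ?thesis
      by (rule finite_subset) auto
  qed
  then have cA: "compact_space H.mtopology"
    by (intro compact_space_hedgehog[where z = "t None"]) (auto simp: A_def w dest: w0)
  define N where "N = metric (A, hedgehog_dist w)"
  have N: "mspace N = A" "mdist N = hedgehog_dist w" "mtopology_of N = H.mtopology"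
    by (simp_all add: N_def)
  have "mspace N \<noteq> {}" "compact_space (mtopology_of N)"
    using cA unfolding N by (auto simp: A_def)
  then obtain f where f: "Lipschitz_quotient M N f"
    using univ by blast
  then obtain L where L: "L > 0"
    "\<And>x y. x \<in> mspace M \<Longrightarrow> y \<in> mspace M \<Longrightarrow> mdist N (f x) (f y) \<le> L * mdist M x y"
    unfolding Lipschitz_quotient_def Lipschitz_continuous_map_pos by blast
  obtain k where k: "L \<le> real k"
    using real_arch_simple by blast
  define tip where "tip i = t (Some (k, i))" for i
  have tipA: "tip i \<in> A" if "i \<le> n k" for i
    using that by (auto simp: A_def tip_def)
  define p where "p i = inv_into (mspace M) f (tip i)" for i
  have p: "p i \<in> mspace M" "f (p i) = tip i" if "i \<le> n k" for i
  proof -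
    have "tip i \<in> f ` mspace M"
      unfolding Lipschitz_quotient_surj[OF f ne] N(1) by (rule tipA[OF that])
    then show "p i \<in> mspace M" "f (p i) = tip i"
      by (simp_all add: p_def inv_into_into f_inv_into_f)
  qed
  have sep: "1 / (real (Suc k))\<^sup>2 \<le> mdist M (p i) (p j)"
    if "i \<le> n k" "j \<le> n k" "i \<noteq> j" for i j
  proof -
    have "2 / real (Suc k) = mdist N (f (p i)) (f (p j))"
      using that inj_eq[OF \<open>inj t\<close>] by (simp add: p(2) tip_def N hedgehog_dist_def w)
    also have "\<dots> \<le> L * mdist M (p i) (p j)"
      using that by (intro L(2) p(1))
    also have "\<dots> \<le> real (Suc k) * mdist M (p i) (p j)"
      using k by (intro mult_right_mono) auto
    finally have "2 / (real (Suc k))\<^sup>2 \<le> mdist M (p i) (p j)"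
      by (simp add: field_simps power2_eq_square del: of_nat_Suc)
    moreover have "1 / (real (Suc k))\<^sup>2 \<le> 2 / (real (Suc k))\<^sup>2"
      by (intro divide_right_mono) auto
    ultimately show ?thesis
      by linarith
  qed
  have "inj_on p {..n k}"
  proof (rule inj_onI, rule ccontr)
    fix i j assume ij: "i \<in> {..n k}" "j \<in> {..n k}" "p i = p j" "i \<noteq> j"
    then have "1 / (real (Suc k))\<^sup>2 \<le> 0"
      using sep[of i j] mdist_zero[OF p(1) p(1), of j j] by simp
    then show False
      by (simp add: divide_le_0_iff del: of_nat_Suc)
  qed
  then have "card (p ` {..n k}) = Suc (n k)"
    by (simp add: card_image)
  moreover have "card (p ` {..n k}) \<le> n k"
    using p(1) sep by (intro n) auto
  ultimately show False
    by simp
qed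

end
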